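(* (Basic law of privacy.) Consider any communication protocol between two parties in which $\delta Q$ qubits are sent between them, an encrypted (private) message of size $\delta M$ (bits if the message is classical, qubits if the message is quantum) is sent, and the length of the private key shared by the two parties changes by $\delta K$. Then $$\delta K\le \delta Q-\delta M .$$
   Context: The two parties (Alice and Bob) may use local operations and arbitrarily many rounds of public classical communication, in addition to sending $\delta Q$ qubits through a quantum channel. A private key of length $K$ is a uniformly random $K$-bit string shared by Alice and Bob and unknown to an eavesdropper Eve, who hears all public communication; $\delta K$ (which may be positive or negative) is the length of the private key at the end minus its length at the start. $\delta M$ is the size of the message (classical or quantum) that is transmitted privately from one party to the other during the protocol; a quantum message consists of unknown states, decoupled from the environment, so the protocol must transmit all $\delta M$-qubit states faithfully (including halves of entangled states), and privately with respect to Eve. *)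

theory Defs
  imports "Jordan_Normal_Form.Schur_Decomposition"
begin

section \<open>Finite-dimensional quantum systems\<close>

text \<open>The basis state \<open>i \<otimes> j\<close> of a composite system has index \<open>i * d + j\<close>, where \<open>d\<close> is the
  dimension of the second factor.\<close>

definition kron :: "complex mat \<Rightarrow> complex mat \<Rightarrow> complex mat" (infixr "\<Otimes>" 72) where
  "A \<Otimes> B = mat (dim_row A * dim_row B) (dim_col A * dim_col B)
     (\<lambda>(i, j). A $$ (i div dim_row B, j div dim_col B) * B $$ (i mod dim_row B, j mod dim_col B))"

definition ket :: "nat \<Rightarrow> nat \<Rightarrow> complex mat" where
  "ket n i = mat_of_cols n [unit_vec n i]"

definition list_sum_mat :: "nat \<Rightarrow> complex mat list \<Rightarrow> complex mat" where
  "list_sum_mat n As = foldr (+) As (0\<^sub>m n n)"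

text \<open>In the order on complex numbers, \<open>0 \<le> z\<close> means that \<open>z\<close> is real and nonnegative, so
  Hermiticity is implied.\<close>

definition density_operator :: "nat \<Rightarrow> complex mat \<Rightarrow> bool" where
  "density_operator n \<rho> \<longleftrightarrow> \<rho> \<in> carrier_mat n n
     \<and> (\<forall>v\<in>carrier_vec n. 0 \<le> (\<rho> *\<^sub>v v) \<bullet>c v)
     \<and> (\<Sum>i<n. \<rho> $$ (i, i)) = 1"

text \<open>A quantum instrument on an \<open>n\<close>-dimensional system: outcome \<open>x\<close> is the pair \<open>E ! x = (d, Ks)\<close> of
  an output dimension and the Kraus operators of a completely positive map into dimension \<open>d\<close>; the
  maps of all outcomes add up to a trace-preserving one.\<close>

type_synonym instrument = "(nat \<times> complex mat list) list"

definition is_instrument :: "nat \<Rightarrow> instrument \<Rightarrow> bool" where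
  "is_instrument n E \<longleftrightarrow>
     (\<forall>(d, Ks)\<in>set E. set Ks \<subseteq> carrier_mat d n)
     \<and> list_sum_mat n (map (\<lambda>K. mat_adjoint K * K) (concat (map snd E))) = 1\<^sub>m n"


section \<open>Protocols\<close>

datatype party = Alice | Bob

primrec other :: "party \<Rightarrow> party" where
  "other Alice = Bob"
| "other Bob = Alice"

text \<open>
  In \<open>Publish P E f\<close>, party \<open>P\<close> applies the instrument \<open>E\<close> to its own system and announces the outcome
  \<open>x\<close> publicly; the protocol goes on with \<open>f x\<close>. An instrument with one outcome is a local operation
  without communication. The several Kraus operators of one outcome account for randomness that \<open>P\<close>
  discards without revealing it; results that \<open>P\<close> keeps secret stay in its system.
  In \<open>Send P p\<close>, party \<open>P\<close> sends one qubit to the other party.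
\<close>

datatype protocol =
    Halt
  | Publish party instrument "nat \<Rightarrow> protocol"
  | Send party protocol

text \<open>The global system is \<open>R \<otimes> A \<otimes> B\<close>: a reference system \<open>R\<close> that no party acts on, and the
  systems of Alice and Bob, of dimensions \<open>r\<close>, \<open>a\<close>, \<open>b\<close>. The qubit sent by Alice is the last tensor
  factor of \<open>A\<close>, which becomes the first one of \<open>B\<close>, and vice versa; a transmission hence changes the
  dimensions but not the global matrix.\<close>

text \<open>\<open>well_formed p a b a' b'\<close>: every run takes local dimensions \<open>a, b\<close> to \<open>a', b'\<close>.\<close>

primrec well_formed :: "protocol \<Rightarrow> nat \<Rightarrow> nat \<Rightarrow> nat \<Rightarrow> nat \<Rightarrow> bool" where
  "well_formed Halt a b a' b' \<longleftrightarrow> a = a' \<and> b = b'"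
| "well_formed (Publish P E f) a b a' b' \<longleftrightarrow>
     (case P of
        Alice \<Rightarrow> is_instrument a E \<and> (\<forall>x<length E. well_formed (f x) (fst (E ! x)) b a' b')
      | Bob \<Rightarrow> is_instrument b E \<and> (\<forall>x<length E. well_formed (f x) a (fst (E ! x)) a' b'))"
| "well_formed (Send P p) a b a' b' \<longleftrightarrow>
     (case P of
        Alice \<Rightarrow> even a \<and> well_formed p (a div 2) (2 * b) a' b'
      | Bob \<Rightarrow> even b \<and> well_formed p (2 * a) (b div 2) a' b')"

definition apply_kraus :: "nat \<Rightarrow> complex mat list \<Rightarrow> complex mat \<Rightarrow> complex mat" where
  "apply_kraus n Vs \<rho> = list_sum_mat n (map (\<lambda>V. V * \<rho> * mat_adjoint V) Vs)"

text \<open>\<open>branches p r a b \<rho>\<close> lists the possible runs on the initial state \<open>\<rho>\<close>: the public transcript, the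
  number of qubits sent, and the final global state, whose trace is the probability of the run.\<close>

primrec branches ::
  "protocol \<Rightarrow> nat \<Rightarrow> nat \<Rightarrow> nat \<Rightarrow> complex mat \<Rightarrow> (nat list \<times> nat \<times> complex mat) list" where
  "branches Halt r a b \<rho> = [([], 0, \<rho>)]"
| "branches (Publish P E f) r a b \<rho> = concat (map (\<lambda>x.
     map (\<lambda>(c, q, \<tau>). (x # c, q, \<tau>))
       (case E ! x of (d, Ks) \<Rightarrow>
         (case P of
            Alice \<Rightarrow> branches (f x) r d b
              (apply_kraus (r * d * b) (map (\<lambda>K. 1\<^sub>m r \<Otimes> K \<Otimes> 1\<^sub>m b) Ks) \<rho>)
          | Bob \<Rightarrow> branches (f x) r a d
              (apply_kraus (r * a * d) (map (\<lambda>K. 1\<^sub>m r \<Otimes> 1\<^sub>m a \<Otimes> K) Ks) \<rho>))))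
     [0..<length E])"
| "branches (Send P p) r a b \<rho> = map (\<lambda>(c, q, \<tau>). (c, Suc q, \<tau>))
     (case P of
        Alice \<Rightarrow> branches p r (a div 2) (2 * b) \<rho>
      | Bob \<Rightarrow> branches p r (2 * a) (b div 2) \<rho>)"


section \<open>Private keys and private messages\<close>

text \<open>Both parties hold a copy of a key of \<open>K\<close> bits; party \<open>P\<close> moreover holds a message system of \<open>M\<close>
  (qu)bits. The two dimension functions give the resulting local dimensions.\<close>

definition dim_Alice :: "party \<Rightarrow> nat \<Rightarrow> nat \<Rightarrow> nat" where
  "dim_Alice P K M = (case P of Alice \<Rightarrow> 2 ^ K * 2 ^ M | Bob \<Rightarrow> 2 ^ K)"

definition dim_Bob :: "party \<Rightarrow> nat \<Rightarrow> nat \<Rightarrow> nat" where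
  "dim_Bob P K M = (case P of Alice \<Rightarrow> 2 ^ K | Bob \<Rightarrow> 2 ^ K * 2 ^ M)"

text \<open>The isometry that adds the key value \<open>k\<close> to a state of reference and message.\<close>

definition add_key :: "nat \<Rightarrow> nat \<Rightarrow> nat \<Rightarrow> party \<Rightarrow> nat \<Rightarrow> complex mat" where
  "add_key r K M P k =
     (case P of
        Alice \<Rightarrow> 1\<^sub>m r \<Otimes> (ket (2 ^ K) k \<Otimes> 1\<^sub>m (2 ^ M)) \<Otimes> ket (2 ^ K) k
      | Bob \<Rightarrow> 1\<^sub>m r \<Otimes> ket (2 ^ K) k \<Otimes> (ket (2 ^ K) k \<Otimes> 1\<^sub>m (2 ^ M)))"

text \<open>A uniformly random shared key of \<open>K\<close> bits, independent of the joint state \<open>\<sigma>\<close> of the reference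
  system and the message system held by \<open>P\<close>.\<close>

definition keyed_state :: "nat \<Rightarrow> nat \<Rightarrow> nat \<Rightarrow> party \<Rightarrow> complex mat \<Rightarrow> complex mat" where
  "keyed_state r K M P \<sigma> = (1 / 2 ^ K) \<cdot>\<^sub>m
     apply_kraus (r * dim_Alice P K M * dim_Bob P K M) (map (add_key r K M P) [0..<2 ^ K]) \<sigma>"

datatype message_kind = Classical | Quantum

text \<open>The states of reference and message that have to be transmitted: all bit strings of length \<open>M\<close>
  (with a trivial reference system), or all states of \<open>M\<close> qubits, possibly entangled with a reference
  system of any dimension.\<close>

definition message_state :: "message_kind \<Rightarrow> nat \<Rightarrow> nat \<Rightarrow> complex mat \<Rightarrow> bool" where
  "message_state kind M r \<sigma> \<longleftrightarrow>
     (case kind of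
        Classical \<Rightarrow> r = 1 \<and> (\<exists>m<2 ^ M. \<sigma> = ket (2 ^ M) m * mat_adjoint (ket (2 ^ M) m))
      | Quantum \<Rightarrow> 0 < r \<and> density_operator (r * 2 ^ M) \<sigma>)"

text \<open>
  The protocol \<open>p\<close> starts with a private key of \<open>K\<close> bits and the message at \<open>sender\<close>, and ends with
  a private key of \<open>K'\<close> bits and the message at the other party, using at most \<open>Q\<close> qubits in any run
  that can occur; all other local systems have been discarded by then.
  Eve's information is the transcript \<open>c\<close>. Privacy of the message is the independence of \<open>prob\<close> from
  \<open>\<sigma>\<close>; privacy of the key is that it is uniform given any transcript and any message.
\<close>

definition private_protocol ::
  "message_kind \<Rightarrow> party \<Rightarrow> protocol \<Rightarrow> nat \<Rightarrow> nat \<Rightarrow> nat \<Rightarrow> nat \<Rightarrow> bool" where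
  "private_protocol kind sender p K K' M Q \<longleftrightarrow>
     well_formed p (dim_Alice sender K M) (dim_Bob sender K M)
       (dim_Alice (other sender) K' M) (dim_Bob (other sender) K' M)
     \<and> (\<exists>prob :: nat list \<Rightarrow> real. \<forall>r \<sigma>. message_state kind M r \<sigma> \<longrightarrow>
         (\<forall>(c, q, \<tau>)\<in>set (branches p r (dim_Alice sender K M) (dim_Bob sender K M)
                             (keyed_state r K M sender \<sigma>)).
            \<tau> = complex_of_real (prob c) \<cdot>\<^sub>m keyed_state r K' M (other sender) \<sigma>
            \<and> (prob c \<noteq> 0 \<longrightarrow> q \<le> Q)))"

end

theory Submission
  imports Defs
begin

text \<open>
  A Schmidt-rank argument. Sending classical basis messages through the protocol is enough, also in the
  quantum case. Let the message label \<open>m\<close>, the initial key and the unannounced Kraus indices be kept by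
  the party that generates them. Conditioned on the transcript, Alice and Bob then share a pure
  (unnormalised) state whose Schmidt rank is at most \<open>2 ^ K\<close> at the start, does not grow under local Kraus
  operators, and at most doubles with every transmitted qubit. At the end, a transcript of nonzero
  probability forces the coefficient matrix to have \<open>2 ^ K' * 2 ^ M\<close> nonzero diagonal blocks (one for each
  pair of a key and a message) and zero off-diagonal blocks, so its rank is at least \<open>2 ^ (K' + M)\<close>.
  Hence \<open>K' + M \<le> K + Q\<close>.
\<close>

section \<open>Matrices and sums\<close>

lemma list_sum_mat_carrier:
  "set As \<subseteq> carrier_mat n n \<Longrightarrow> list_sum_mat n As \<in> carrier_mat n n"
  by (induction As) (auto simp: list_sum_mat_def)

lemma index_list_sum_mat:
  assumes "set As \<subseteq> carrier_mat n n" "x < n" "y < n"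
  shows "list_sum_mat n As $$ (x, y) = (\<Sum>A\<leftarrow>As. A $$ (x, y))"
  using assms(1)
proof (induction As)
  case Nil
  then show ?case using assms by (simp add: list_sum_mat_def)
next
  case (Cons A As)
  then have "list_sum_mat n As \<in> carrier_mat n n" by (simp add: list_sum_mat_carrier)
  with Cons assms show ?case by (simp add: list_sum_mat_def)
qed

lemma mat_adjoint_carrier [simp]:
  "A \<in> carrier_mat m n \<Longrightarrow> mat_adjoint A \<in> carrier_mat n m"
  by (auto simp: mat_adjoint_def)

lemma dim_mat_adjoint [simp]:
  "dim_row (mat_adjoint A) = dim_col A" "dim_col (mat_adjoint A) = dim_row A"
  by (simp_all add: mat_adjoint_def)

lemma index_mat_adjoint [simp]:
  "x < dim_col A \<Longrightarrow> y < dim_row A \<Longrightarrow> mat_adjoint A $$ (x, y) = cnj (A $$ (y, x))"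
  by (simp add: mat_adjoint_def mat_of_rows_index)

lemma index_mult_mat_sum:
  assumes "A \<in> carrier_mat m n" "B \<in> carrier_mat n l" "x < m" "y < l"
  shows "(A * B) $$ (x, y) = (\<Sum>k<n. A $$ (x, k) * B $$ (k, y))"
  using assms by (simp add: scalar_prod_def atLeast0LessThan)

section \<open>Sums over composite indices and over lists\<close>

lemma sum_lessThan_mult:
  fixes f :: "nat \<Rightarrow> 'a::comm_monoid_add"
  shows "(\<Sum>x<m * n. f x) = (\<Sum>i<m. \<Sum>j<n. f (i * n + j))"
proof (induction m)
  case (Suc m)
  have add: "(\<Sum>x<k + l. f x) = (\<Sum>x<k. f x) + (\<Sum>j<l. f (k + j))" for k l
    by (induction l) (simp_all add: add.assoc)
  have "(\<Sum>x<Suc m * n. f x) = (\<Sum>x<m * n + n. f x)" by (simp add: add.commute)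
  also have "\<dots> = (\<Sum>x<m * n. f x) + (\<Sum>j<n. f (m * n + j))" by (rule add)
  finally show ?case using Suc by simp
qed simp

lemma mult_add_less:
  fixes i j m n :: nat
  assumes "i < m" "j < n"
  shows "i * n + j < m * n"
proof -
  have "i * n + j < Suc i * n" using assms by simp
  also have "\<dots> \<le> m * n" using assms by (intro mult_le_mono1) simp
  finally show ?thesis .
qed

lemma div_less_of_less_mult: "x < m * n \<Longrightarrow> x div n < (m::nat)"
  by (simp add: less_mult_imp_div_less)

lemma mod_less_of_less_mult: "x < m * n \<Longrightarrow> x mod n < (n::nat)"
  by (cases n) auto

lemma div_mult_add [simp]: "j < n \<Longrightarrow> (i * n + j) div n = (i::nat)"
  by simp

lemma mod_mult_add [simp]: "j < n \<Longrightarrow> (i * n + j) mod n = (j::nat)"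
  by simp

lemma sum_list_swap:
  fixes f :: "'a \<Rightarrow> 'b \<Rightarrow> 'c::comm_monoid_add"
  shows "(\<Sum>x\<leftarrow>xs. \<Sum>y\<leftarrow>ys. f x y) = (\<Sum>y\<leftarrow>ys. \<Sum>x\<leftarrow>xs. f x y)"
  by (induction xs) (simp_all add: sum_list_addf)

lemma sum_list_concat_map:
  fixes f :: "'b \<Rightarrow> 'c::comm_monoid_add"
  shows "(\<Sum>y\<leftarrow>concat (map g xs). f y) = (\<Sum>x\<leftarrow>xs. \<Sum>y\<leftarrow>g x. f y)"
  by (induction xs) simp_all

lemma sum_sum_list_swap:
  fixes f :: "'a \<Rightarrow> 'b \<Rightarrow> 'c::comm_monoid_add"
  shows "(\<Sum>x\<in>X. \<Sum>y\<leftarrow>ys. f x y) = (\<Sum>y\<leftarrow>ys. \<Sum>x\<in>X. f x y)"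
  by (induction ys) (simp_all add: sum.distrib)

section \<open>Bipartite states of bounded Schmidt rank\<close>

text \<open>The common weight \<open>c\<close> stays outside the vectors so that the factor
  \<open>1 / 2 ^ K\<close> of a random key needs no square roots.\<close>

definition mixture :: "complex \<Rightarrow> nat \<Rightarrow> (nat \<Rightarrow> complex) list \<Rightarrow> complex mat \<Rightarrow> bool" where
  "mixture c n vs \<rho> \<longleftrightarrow> \<rho> \<in> carrier_mat n n
     \<and> (\<forall>x<n. \<forall>y<n. \<rho> $$ (x, y) = c * (\<Sum>v\<leftarrow>vs. v x * cnj (v y)))"

text \<open>Conjugation by \<open>V\<close> turns the rank-one term of \<open>v\<close> into that of
  \<open>V v\<close>. An unannounced Kraus index thus becomes a label of the ensemble: one vector
  for each pair of an operator and an old vector, never a superposition of them.\<close>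

lemma mixture_apply_kraus:
  assumes \<rho>: "mixture c n vs \<rho>" and Vs: "set Vs \<subseteq> carrier_mat n' n"
  shows "mixture c n' (concat (map (\<lambda>V. map (\<lambda>v x. \<Sum>y<n. V $$ (x, y) * v y) vs) Vs))
           (apply_kraus n' Vs \<rho>)"
proof -
  have \<rho>c: "\<rho> \<in> carrier_mat n n" using \<rho> by (simp add: mixture_def)
  have terms: "set (map (\<lambda>V. V * \<rho> * mat_adjoint V) Vs) \<subseteq> carrier_mat n' n'"
    using Vs \<rho>c by (auto intro!: mult_carrier_mat mat_adjoint_carrier)
  have one: "(V * \<rho> * mat_adjoint V) $$ (x, x')
      = c * (\<Sum>v\<leftarrow>vs. (\<Sum>y<n. V $$ (x, y) * v y) * cnj (\<Sum>y<n. V $$ (x', y) * v y))"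
    if V: "V \<in> set Vs" and x: "x < n'" "x' < n'" for V x x'
  proof -
    have Vc: "V \<in> carrier_mat n' n" using V Vs by auto
    have "(V * \<rho> * mat_adjoint V) $$ (x, x')
        = (\<Sum>y'<n. (\<Sum>y<n. V $$ (x, y) * \<rho> $$ (y, y')) * cnj (V $$ (x', y')))"
      using Vc x \<rho>c
      by (subst index_mult_mat_sum[of _ n' n _ n'])
        (auto intro!: sum.cong simp: index_mult_mat_sum[OF Vc \<rho>c] simp del: index_mult_mat)
    also have "\<dots> = (\<Sum>y'<n. \<Sum>y<n. \<Sum>v\<leftarrow>vs. c * ((V $$ (x, y) * v y) * cnj (V $$ (x', y') * v y')))"
      unfolding sum_distrib_right
    proof (intro sum.cong refl)
      fix y y' assume "y \<in> {..<n}" "y' \<in> {..<n}"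
      then have "\<rho> $$ (y, y') = c * (\<Sum>v\<leftarrow>vs. v y * cnj (v y'))"
        using \<rho> by (simp add: mixture_def)
      then have "V $$ (x, y) * \<rho> $$ (y, y') * cnj (V $$ (x', y'))
          = (c * V $$ (x, y) * cnj (V $$ (x', y'))) * (\<Sum>v\<leftarrow>vs. v y * cnj (v y'))"
        by (simp add: mult_ac)
      also have "\<dots> = (\<Sum>v\<leftarrow>vs. c * ((V $$ (x, y) * v y) * cnj (V $$ (x', y') * v y')))"
        unfolding sum_list_const_mult[symmetric] by (simp add: mult_ac)
      finally show "V $$ (x, y) * \<rho> $$ (y, y') * cnj (V $$ (x', y'))
          = (\<Sum>v\<leftarrow>vs. c * ((V $$ (x, y) * v y) * cnj (V $$ (x', y') * v y')))" .
    qed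
    also have "\<dots> = (\<Sum>v\<leftarrow>vs. \<Sum>y'<n. \<Sum>y<n. c * ((V $$ (x, y) * v y) * cnj (V $$ (x', y') * v y')))"
      by (simp add: sum_sum_list_swap)
    also have "\<dots> = (\<Sum>v\<leftarrow>vs. c * ((\<Sum>y<n. V $$ (x, y) * v y) * cnj (\<Sum>y<n. V $$ (x', y) * v y)))"
    proof (intro arg_cong[where f=sum_list] map_cong refl)
      fix v
      show "(\<Sum>y'<n. \<Sum>y<n. c * ((V $$ (x, y) * v y) * cnj (V $$ (x', y') * v y')))
          = c * ((\<Sum>y<n. V $$ (x, y) * v y) * cnj (\<Sum>y<n. V $$ (x', y) * v y))"
        unfolding cnj_sum sum_product unfolding sum_distrib_left by (rule sum.swap)
    qed
    finally show ?thesis by (simp add: sum_list_const_mult)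
  qed
  have "apply_kraus n' Vs \<rho> $$ (x, x')
      = c * (\<Sum>v\<leftarrow>concat (map (\<lambda>V. map (\<lambda>v x. \<Sum>y<n. V $$ (x, y) * v y) vs) Vs). v x * cnj (v x'))"
    if x: "x < n'" "x' < n'" for x x'
  proof -
    have "apply_kraus n' Vs \<rho> $$ (x, x') = (\<Sum>V\<leftarrow>Vs. (V * \<rho> * mat_adjoint V) $$ (x, x'))"
      unfolding apply_kraus_def using index_list_sum_mat[OF terms x] by (simp add: o_def)
    also have "\<dots> = (\<Sum>V\<leftarrow>Vs. c * (\<Sum>v\<leftarrow>vs. (\<Sum>y<n. V $$ (x, y) * v y) * cnj (\<Sum>y<n. V $$ (x', y) * v y)))"
      using one x by (intro arg_cong[where f=sum_list] map_cong) auto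
    finally show ?thesis by (simp add: sum_list_concat_map sum_list_const_mult o_def)
  qed
  moreover have "apply_kraus n' Vs \<rho> \<in> carrier_mat n' n'"
    unfolding apply_kraus_def by (rule list_sum_mat_carrier[OF terms])
  ultimately show ?thesis by (simp add: mixture_def)
qed

text \<open>Only the sum of the rank-one terms matters, so the list may be reordered or its vectors
  changed at indices from \<open>n\<close> on.\<close>

lemma mixture_cong:
  assumes "mixture c n vs \<rho>"
    and "\<And>x y. x < n \<Longrightarrow> y < n \<Longrightarrow> (\<Sum>v\<leftarrow>vs. v x * cnj (v y)) = (\<Sum>v\<leftarrow>vs'. v x * cnj (v y))"
  shows "mixture c n vs' \<rho>"
  using assms by (simp add: mixture_def)

section \<open>Tensor products, local operations and transmissions\<close>

lemma kron_carrier: "A \<in> carrier_mat m n \<Longrightarrow> B \<in> carrier_mat m' n' \<Longrightarrow> A \<Otimes> B \<in> carrier_mat (m * m') (n * n')"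
  by (auto simp: kron_def)

lemma index_kron:
  assumes "A \<in> carrier_mat m n" "B \<in> carrier_mat m' n'" "x < m * m'" "y < n * n'"
  shows "(A \<Otimes> B) $$ (x, y) = A $$ (x div m', y div n') * B $$ (x mod m', y mod n')"
  using assms by (auto simp: kron_def)

text \<open>Removes a trivial reference system from Kraus operators and from \<open>add_key\<close>;
  \<open>Suc 0\<close> is the simplifier's form of \<open>1\<close>.\<close>

lemma kron_one_left [simp]: "1\<^sub>m (Suc 0) \<Otimes> A = A"
  by (rule eq_matI) (auto simp: kron_def)

text \<open>A function \<open>U\<close> stands for a matrix with rows indexed by a local system and columns by the Schmidt
  index \<open>g < t\<close>; \<open>amp\<close> is the vector of entries of \<open>U W\<^sup>T\<close>, hence has Schmidt rank at most \<open>t\<close>.\<close>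

definition amp :: "nat \<Rightarrow> nat \<Rightarrow> (nat \<Rightarrow> nat \<Rightarrow> complex) \<Rightarrow> (nat \<Rightarrow> nat \<Rightarrow> complex) \<Rightarrow> nat \<Rightarrow> complex" where
  "amp t b U W x = (\<Sum>g<t. U (x div b) g * W (x mod b) g)"

text \<open>The matrix product \<open>K U\<close>. It acts on rows only, so local operations leave
  the number of Schmidt indices as it is.\<close>

definition act :: "nat \<Rightarrow> complex mat \<Rightarrow> (nat \<Rightarrow> nat \<Rightarrow> complex) \<Rightarrow> nat \<Rightarrow> nat \<Rightarrow> complex" where
  "act n K U i g = (\<Sum>l<n. K $$ (i, l) * U l g)"

text \<open>In matrix form, \<open>K \<Otimes> 1\<close> sends \<open>U W\<^sup>T\<close> to
  \<open>(K U) W\<^sup>T\<close>; the identity factor collapses the sum over Bob's index to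
  \<open>j = x mod b\<close>.\<close>

lemma amp_act_Alice:
  assumes K: "K \<in> carrier_mat d a" and x: "x < d * b"
  shows "(\<Sum>y<a * b. (K \<Otimes> 1\<^sub>m b) $$ (x, y) * amp t b U W y) = amp t b (act a K U) W x"
proof -
  have b: "x mod b < b" using x by (rule mod_less_of_less_mult)
  have "(\<Sum>y<a * b. (K \<Otimes> 1\<^sub>m b) $$ (x, y) * amp t b U W y)
      = (\<Sum>i<a. \<Sum>j<b. if j = x mod b then K $$ (x div b, i) * amp t b U W (i * b + j) else 0)"
    unfolding sum_lessThan_mult using b
    by (intro sum.cong) (auto simp: index_kron[OF K one_carrier_mat x] mult_add_less)
  also have "\<dots> = (\<Sum>i<a. K $$ (x div b, i) * amp t b U W (i * b + x mod b))"
    using b by simp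
  also have "\<dots> = amp t b (act a K U) W x"
    using b unfolding amp_def act_def
    by (simp add: sum_distrib_left sum_distrib_right mult.assoc) (rule sum.swap)
  finally show ?thesis .
qed

text \<open>The mirror image: \<open>U W\<^sup>T\<close> becomes \<open>U (K W)\<^sup>T\<close>.
  Bob's factor is the last one, so the output dimension \<open>d\<close> also replaces
  \<open>b\<close> in the splitting of \<open>x\<close>.\<close>

lemma amp_act_Bob:
  assumes K: "K \<in> carrier_mat d b" and x: "x < a * d"
  shows "(\<Sum>y<a * b. (1\<^sub>m a \<Otimes> K) $$ (x, y) * amp t b U W y) = amp t d U (act b K W) x"
proof -
  have a: "x div d < a" using x by (rule div_less_of_less_mult)
  have d: "x mod d < d" using x by (rule mod_less_of_less_mult)
  have "(\<Sum>y<a * b. (1\<^sub>m a \<Otimes> K) $$ (x, y) * amp t b U W y)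
      = (\<Sum>i<a. \<Sum>j<b. if i = x div d then K $$ (x mod d, j) * amp t b U W (i * b + j) else 0)"
    unfolding sum_lessThan_mult using a
    by (intro sum.cong) (auto simp: index_kron[OF one_carrier_mat K x] mult_add_less)
  also have "\<dots> = (\<Sum>i<a. if i = x div d then \<Sum>j<b. K $$ (x mod d, j) * amp t b U W (i * b + j) else 0)"
    by (intro sum.cong) auto
  also have "\<dots> = (\<Sum>j<b. K $$ (x mod d, j) * amp t b U W ((x div d) * b + j))"
    using a by simp
  also have "\<dots> = (\<Sum>j<b. \<Sum>g<t. K $$ (x mod d, j) * (U (x div d) g * W j g))"
    by (simp add: amp_def sum_distrib_left)
  also have "\<dots> = amp t d U (act b K W) x"
    unfolding amp_def act_def
    by (subst sum.swap) (simp add: sum_distrib_left mult.assoc mult.left_commute)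
  finally show ?thesis .
qed

text \<open>The Schmidt index of the state after a transmission is \<open>2 * g + r\<close>, where \<open>r\<close> is the value of the
  transmitted qubit.\<close>

definition split_last :: "(nat \<Rightarrow> nat \<Rightarrow> complex) \<Rightarrow> nat \<Rightarrow> nat \<Rightarrow> complex" where
  "split_last U i g = U (2 * i + g mod 2) (g div 2)"

definition join_first :: "nat \<Rightarrow> (nat \<Rightarrow> nat \<Rightarrow> complex) \<Rightarrow> nat \<Rightarrow> nat \<Rightarrow> complex" where
  "join_first b W j g = (if j div b = g mod 2 then W (j mod b) (g div 2) else 0)"

definition split_first :: "nat \<Rightarrow> (nat \<Rightarrow> nat \<Rightarrow> complex) \<Rightarrow> nat \<Rightarrow> nat \<Rightarrow> complex" where
  "split_first b W j g = W ((g mod 2) * b + j) (g div 2)"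

definition join_last :: "(nat \<Rightarrow> nat \<Rightarrow> complex) \<Rightarrow> nat \<Rightarrow> nat \<Rightarrow> complex" where
  "join_last U i g = (if i mod 2 = g mod 2 then U (i div 2) (g div 2) else 0)"

text \<open>The global vector is unchanged and only the cut between the parties moves. The sent
  qubit is summed over as part of the Schmidt index, with a delta on the receiver's side, which
  doubles the number of Schmidt indices.\<close>

lemma amp_send_Alice:
  assumes "0 < b"
  shows "amp (t * 2) (2 * b) (split_last U) (join_first b W) x = amp t b U W x"
proof -
  \<comment> \<open>The sent qubit is the last bit of Alice's old index \<open>x div b\<close> and
    the leading digit of Bob's new index \<open>x mod (2 * b)\<close>.\<close>
  let ?q = "(x mod (2 * b)) div b"
  have q: "?q < 2" using assms by (simp add: less_mult_imp_div_less)
  have x: "2 * (x div (2 * b)) + ?q = x div b"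
    by (metis div_mult2_eq mod_mult2_eq mult.commute mult_div_mod_eq assms
        add.commute div_mult_self4 mod_div_trivial add_0 less_not_refl)
  have m: "x mod (2 * b) mod b = x mod b" by (simp add: mod_mod_cancel)
  have "amp (t * 2) (2 * b) (split_last U) (join_first b W) x
      = (\<Sum>g<t. \<Sum>r<2. if r = ?q then U (2 * (x div (2 * b)) + r) g * W (x mod b) g else 0)"
    unfolding amp_def sum_lessThan_mult
    by (intro sum.cong refl) (auto simp: split_last_def join_first_def m)
  also have "\<dots> = amp t b U W x"
    using q x by (simp add: amp_def)
  finally show ?thesis .
qed

lemma amp_send_Bob:
  assumes "0 < b"
  shows "amp (t * 2) b (join_last U) (split_first b W) x = amp t (2 * b) U W x"
proof -
  let ?q = "(x div b) mod 2"
  have q: "?q < 2" by simp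
  have x: "?q * b + x mod b = x mod (2 * b)"
    by (metis mod_mult2_eq mult.commute)
  have m: "x div b div 2 = x div (2 * b)" by (simp add: div_mult2_eq mult.commute)
  have "amp (t * 2) b (join_last U) (split_first b W) x
      = (\<Sum>g<t. \<Sum>r<2. if r = ?q then U (x div (2 * b)) g * W (r * b + x mod b) g else 0)"
    unfolding amp_def sum_lessThan_mult
    by (intro sum.cong refl) (auto simp: split_first_def join_last_def m)
  also have "\<dots> = amp t (2 * b) U W x"
    using q x by (simp add: amp_def)
  finally show ?thesis .
qed

section \<open>Instruments, rank and diagonal entries\<close>

lemma is_instrument_nth_carrier:
  assumes "is_instrument n E" "x < length E"
  shows "set (snd (E ! x)) \<subseteq> carrier_mat (fst (E ! x)) n"
proof -
  have "\<forall>e\<in>set E. set (snd e) \<subseteq> carrier_mat (fst e) n"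
    using assms(1) unfolding is_instrument_def case_prod_beta by (rule conjunct1)
  with assms(2) show ?thesis by (metis nth_mem)
qed

text \<open>If every \<open>K v\<close> vanished, so would \<open>v\<close>, which by completeness
  is the sum of the vectors \<open>mat_adjoint K * K\<close> applied to \<open>v\<close>. Hence a
  possible run can always be continued by some announced outcome.\<close>

lemma instrument_nonzero:
  assumes E: "is_instrument n E" and i: "i < n" "v i \<noteq> 0"
  obtains x K l where "x < length E" "K \<in> set (snd (E ! x))" "l < fst (E ! x)"
    "(\<Sum>j<n. K $$ (l, j) * v j) \<noteq> (0::complex)"
proof (rule ccontr)
  assume "\<not> thesis"
  then have none: "\<And>x K l. x < length E \<Longrightarrow> K \<in> set (snd (E ! x)) \<Longrightarrow> l < fst (E ! x)
      \<Longrightarrow> (\<Sum>j<n. K $$ (l, j) * v j) = 0"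
    using that by blast
  let ?Ks = "concat (map snd E)"
  have zero: "(\<Sum>j<n. K $$ (l, j) * v j) = 0" if "K \<in> set ?Ks" "l < dim_row K" for K l
  proof (rule ccontr)
    assume nz: "(\<Sum>j<n. K $$ (l, j) * v j) \<noteq> 0"
    from that(1) obtain x where x: "x < length E" "K \<in> set (snd (E ! x))"
      by (auto simp: in_set_conv_nth[of _ E])
    have "K \<in> carrier_mat (fst (E ! x)) n"
      using is_instrument_nth_carrier[OF E x(1)] x(2) by blast
    then have "l < fst (E ! x)" using that(2) by simp
    with x nz none show False by blast
  qed
  have Kc: "K \<in> carrier_mat (dim_row K) n" if "K \<in> set ?Ks" for K
  proof -
    from that obtain e where e: "e \<in> set E" "K \<in> set (snd e)" by auto
    then obtain x where x: "x < length E" "e = E ! x" by (auto simp: in_set_conv_nth)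
    with e is_instrument_nth_carrier[OF E x(1)] show ?thesis by (metis carrier_matD(1) subsetD)
  qed
  have terms: "set (map (\<lambda>K. mat_adjoint K * K) ?Ks) \<subseteq> carrier_mat n n"
    using Kc by (auto intro!: mult_carrier_mat mat_adjoint_carrier)
  have one: "(if i = j then 1 else 0) = (\<Sum>K\<leftarrow>?Ks. \<Sum>l<dim_row K. cnj (K $$ (l, i)) * K $$ (l, j))"
    if j: "j < n" for j
  proof -
    have "(if i = j then 1 else 0) = list_sum_mat n (map (\<lambda>K. mat_adjoint K * K) ?Ks) $$ (i, j)"
      using E i j by (simp add: is_instrument_def)
    also have "\<dots> = (\<Sum>K\<leftarrow>?Ks. (mat_adjoint K * K) $$ (i, j))"
      using index_list_sum_mat[OF terms i(1) j] by (simp add: o_def)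
    also have "\<dots> = (\<Sum>K\<leftarrow>?Ks. \<Sum>l<dim_row K. cnj (K $$ (l, i)) * K $$ (l, j))"
    proof (intro arg_cong[where f=sum_list] map_cong refl)
      fix K assume "K \<in> set ?Ks"
      note K = Kc[OF this]
      show "(mat_adjoint K * K) $$ (i, j) = (\<Sum>l<dim_row K. cnj (K $$ (l, i)) * K $$ (l, j))"
        using i j carrier_matD(2)[OF K]
        by (subst index_mult_mat_sum[OF mat_adjoint_carrier[OF K] K])
          (simp_all cong: sum.cong_simp)
    qed
    finally show ?thesis .
  qed
  have "v i = (\<Sum>j<n. (if i = j then 1 else 0) * v j)"
    using i by (simp add: if_distrib[of "\<lambda>c. c * _"] cong: if_cong)
  also have "\<dots> = (\<Sum>j<n. \<Sum>K\<leftarrow>?Ks. \<Sum>l<dim_row K. cnj (K $$ (l, i)) * (K $$ (l, j) * v j))"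
    by (intro sum.cong refl)
      (simp add: one sum_distrib_right mult.assoc flip: sum_list_mult_const)
  also have "\<dots> = (\<Sum>K\<leftarrow>?Ks. \<Sum>l<dim_row K. cnj (K $$ (l, i)) * (\<Sum>j<n. K $$ (l, j) * v j))"
    unfolding sum_sum_list_swap sum_distrib_left
    by (intro arg_cong[where f=sum_list] map_cong refl sum.swap)
  also have "\<dots> = (\<Sum>K\<leftarrow>?Ks. 0)"
    using zero by (intro arg_cong[where f=sum_list] map_cong refl sum.neutral) auto
  finally show False using i by simp
qed

text \<open>If \<open>t < N\<close>, padding both factors with zeros to size \<open>N\<close> makes
  the determinant of their product zero, whereas a diagonal matrix with nonzero diagonal entries is
  invertible.\<close>

lemma rank_bound:
  fixes f g :: "nat \<Rightarrow> nat \<Rightarrow> complex"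
  assumes diag: "\<And>x. x < N \<Longrightarrow> (\<Sum>k<t. f x k * g x k) \<noteq> 0"
    and off: "\<And>x y. x < N \<Longrightarrow> y < N \<Longrightarrow> x \<noteq> y \<Longrightarrow> (\<Sum>k<t. f x k * g y k) = 0"
  shows "N \<le> t"
proof (rule ccontr)
  assume "\<not> N \<le> t"
  then have tN: "t < N" by simp
  define F where "F = mat N N (\<lambda>(x, k). if k < t then f x k else 0)"
  define G where "G = mat N N (\<lambda>(k, y). if k < t then g y k else 0)"
  have FG: "(F * G) $$ (x, y) = (\<Sum>k<t. f x k * g y k)" if "x < N" "y < N" for x y
  proof -
    have "(F * G) $$ (x, y) = (\<Sum>k<N. if k < t then f x k * g y k else 0)"
      using that by (subst index_mult_mat_sum[of _ N N _ N]) (auto simp: F_def G_def intro!: sum.cong)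
    also have "\<dots> = (\<Sum>k<t. f x k * g y k)"
      using tN by (intro sum.mono_neutral_cong_right) auto
    finally show ?thesis .
  qed
  have "det (F * G) = det F * det G" by (rule det_mult) (auto simp: F_def G_def)
  also have "det G = 0"
  proof (rule ccontr)
    assume nz: "det G \<noteq> 0"
    \<comment> \<open>Row \<open>t\<close> of \<open>G\<close> is padding, and it exists because
      \<open>t < N\<close>.\<close>
    have "G = mat\<^sub>r N N (\<lambda>k. if k = t then 0\<^sub>v N else row G k)"
      by (rule eq_matI) (auto simp: G_def)
    moreover have "det (mat\<^sub>r N N (\<lambda>k. if k = t then 0\<^sub>v N else row G k)) = 0"
      using tN by (intro det_row_0) (auto simp: G_def)
    ultimately have "det G = 0" by simp
    with nz show False by simp
  qed
  finally have "det (F * G) = 0" by simp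
  moreover have "det (F * G) = prod_list (diag_mat (F * G))"
    using off FG by (intro det_upper_triangular[of _ N]) (auto simp: F_def G_def)
  ultimately show False using diag FG
    by (auto simp: prod_list_zero_iff diag_mat_def F_def G_def)
qed

text \<open>A diagonal entry is \<open>c\<close> times a sum of squared moduli, so nothing cancels:
  the support of the state restricts every single vector of the ensemble.\<close>

lemma mixture_diag_eq_0_iff:
  assumes \<rho>: "mixture c n vs \<rho>" and c: "c \<noteq> 0" and x: "x < n"
  shows "\<rho> $$ (x, x) = 0 \<longleftrightarrow> (\<forall>v\<in>set vs. v x = 0)"
proof -
  have sq: "(\<Sum>v\<leftarrow>vs. v x * cnj (v x)) = of_real (\<Sum>v\<leftarrow>vs. (cmod (v x))\<^sup>2)"
    by (induction vs) (simp_all add: complex_norm_square del: of_real_power)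
  have "(\<Sum>v\<leftarrow>vs. (cmod (v x))\<^sup>2) = 0 \<longleftrightarrow> (\<forall>v\<in>set vs. v x = 0)"
    by (subst sum_list_nonneg_eq_0_iff) auto
  then show ?thesis
    using \<rho> c x by (simp add: mixture_def sq)
qed

lemma mixture_smult: "mixture c n vs \<rho> \<Longrightarrow> mixture (d * c) n vs (d \<cdot>\<^sub>m \<rho>)"
  by (auto simp: mixture_def mult.assoc)

section \<open>Pure states along a run, indexed by private records\<close>

text \<open>All records of Alice are paired with all records of Bob. This product form lets the
  final rank estimate combine Alice's record from one pair with Bob's from another.\<close>

definition products ::
  "nat \<Rightarrow> nat \<Rightarrow> (nat \<Rightarrow> nat \<Rightarrow> complex) list \<Rightarrow> (nat \<Rightarrow> nat \<Rightarrow> complex) list \<Rightarrow> (nat \<Rightarrow> complex) list" where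
  "products t b As Bs = concat (map (\<lambda>U. map (amp t b U) Bs) As)"

text \<open>For each message \<open>m\<close>, the lists \<open>As m\<close> and \<open>Bs m\<close> run over the private records of Alice and Bob.
  Only the party \<open>s\<close> that sends the message has a record of \<open>m\<close>, so the list of the other party does not
  depend on it. The last conjunct keeps the transcript possible.\<close>

definition dilated :: "party \<Rightarrow> complex \<Rightarrow> nat \<Rightarrow> nat \<Rightarrow> nat
    \<Rightarrow> (nat \<Rightarrow> (nat \<Rightarrow> nat \<Rightarrow> complex) list) \<Rightarrow> (nat \<Rightarrow> (nat \<Rightarrow> nat \<Rightarrow> complex) list) \<Rightarrow> (nat \<Rightarrow> complex mat) \<Rightarrow> bool" where
  "dilated s c t a b As Bs \<rho> \<longleftrightarrow>
     (\<forall>m. mixture c (a * b) (products t b (As m) (Bs m)) (\<rho> m))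
     \<and> (case s of Alice \<Rightarrow> \<exists>Bs0. Bs = (\<lambda>_. Bs0) | Bob \<Rightarrow> \<exists>As0. As = (\<lambda>_. As0))
     \<and> (\<exists>U\<in>set (As 0). \<exists>W\<in>set (Bs 0). \<exists>x<a * b. amp t b U W x \<noteq> 0)"

lemma sum_list_products:
  "(\<Sum>v\<leftarrow>products t b As Bs. f v) = (\<Sum>U\<leftarrow>As. \<Sum>W\<leftarrow>Bs. (f (amp t b U W) :: complex))"
  by (simp add: products_def sum_list_concat_map o_def)

lemma mixture_Alice:
  assumes \<rho>: "mixture c (a * b) (products t b As Bs) \<rho>" and Ks: "set Ks \<subseteq> carrier_mat d a"
  shows "mixture c (d * b) (products t b (concat (map (\<lambda>K. map (act a K) As) Ks)) Bs)
           (apply_kraus (d * b) (map (\<lambda>K. K \<Otimes> 1\<^sub>m b) Ks) \<rho>)"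
proof (rule mixture_cong[OF mixture_apply_kraus[OF \<rho>]])
  show "set (map (\<lambda>K. K \<Otimes> 1\<^sub>m b) Ks) \<subseteq> carrier_mat (d * b) (a * b)"
    using Ks by (auto intro!: kron_carrier)
  fix x y assume xy: "x < d * b" "y < d * b"
  show "(\<Sum>v\<leftarrow>concat (map (\<lambda>V. map (\<lambda>v x. \<Sum>y<a * b. V $$ (x, y) * v y) (products t b As Bs))
          (map (\<lambda>K. K \<Otimes> 1\<^sub>m b) Ks)). v x * cnj (v y))
      = (\<Sum>v\<leftarrow>products t b (concat (map (\<lambda>K. map (act a K) As) Ks)) Bs. v x * cnj (v y))"
    unfolding sum_list_products sum_list_concat_map
    using Ks xy by (auto intro!: arg_cong[where f=sum_list] simp: o_def sum_list_products amp_act_Alice[OF subsetD[OF Ks]] simp del: cnj_sum)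
qed

lemma mixture_Bob:
  assumes \<rho>: "mixture c (a * b) (products t b As Bs) \<rho>" and Ks: "set Ks \<subseteq> carrier_mat d b"
  shows "mixture c (a * d) (products t d As (concat (map (\<lambda>K. map (act b K) Bs) Ks)))
           (apply_kraus (a * d) (map (\<lambda>K. 1\<^sub>m a \<Otimes> K) Ks) \<rho>)"
proof (rule mixture_cong[OF mixture_apply_kraus[OF \<rho>]])
  show "set (map (\<lambda>K. 1\<^sub>m a \<Otimes> K) Ks) \<subseteq> carrier_mat (a * d) (a * b)"
    using Ks by (auto intro!: kron_carrier)
  fix x y assume xy: "x < a * d" "y < a * d"
  have "(\<Sum>v\<leftarrow>concat (map (\<lambda>V. map (\<lambda>v x. \<Sum>y<a * b. V $$ (x, y) * v y) (products t b As Bs))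
          (map (\<lambda>K. 1\<^sub>m a \<Otimes> K) Ks)). v x * cnj (v y))
      = (\<Sum>K\<leftarrow>Ks. \<Sum>U\<leftarrow>As. \<Sum>W\<leftarrow>Bs. amp t d U (act b K W) x * cnj (amp t d U (act b K W) y))"
    unfolding sum_list_products sum_list_concat_map
    using Ks xy by (auto intro!: arg_cong[where f=sum_list] simp: o_def sum_list_products amp_act_Bob[OF subsetD[OF Ks]] simp del: cnj_sum)
  \<comment> \<open>The Kraus index comes outermost from \<open>mixture_apply_kraus\<close>, but as
    part of Bob's record it belongs inside the sum over Alice's records.\<close>
  also have "\<dots> = (\<Sum>v\<leftarrow>products t d As (concat (map (\<lambda>K. map (act b K) Bs) Ks)). v x * cnj (v y))"
    by (subst sum_list_swap) (simp add: sum_list_products sum_list_concat_map o_def)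
  finally show "(\<Sum>v\<leftarrow>concat (map (\<lambda>V. map (\<lambda>v x. \<Sum>y<a * b. V $$ (x, y) * v y) (products t b As Bs))
          (map (\<lambda>K. 1\<^sub>m a \<Otimes> K) Ks)). v x * cnj (v y))
      = (\<Sum>v\<leftarrow>products t d As (concat (map (\<lambda>K. map (act b K) Bs) Ks)). v x * cnj (v y))" .
qed

text \<open>The outcome is chosen to keep a nonzero amplitude for message 0 and then followed for
  all \<open>m\<close> at once. The same operators act for each \<open>m\<close>, so a list
  independent of \<open>m\<close> remains so.\<close>

lemma dilated_Alice:
  assumes D: "dilated s c t a b As Bs \<rho>" and E: "is_instrument a E"
  obtains x where "x < length E"
    "dilated s c t (fst (E ! x)) b (\<lambda>m. concat (map (\<lambda>K. map (act a K) (As m)) (snd (E ! x)))) Bs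
       (\<lambda>m. apply_kraus (fst (E ! x) * b) (map (\<lambda>K. K \<Otimes> 1\<^sub>m b) (snd (E ! x))) (\<rho> m))"
proof -
  from D obtain U W y where UW: "U \<in> set (As 0)" "W \<in> set (Bs 0)" and y: "y < a * b" "amp t b U W y \<noteq> 0"
    by (auto simp: dilated_def)
  let ?j = "y mod b"
  have j: "?j < b" using y by (auto intro: mod_less_of_less_mult)
  \<comment> \<open>Freezing Bob's index where the amplitude is nonzero leaves a nonzero vector on
    Alice's system.\<close>
  let ?v = "\<lambda>i. amp t b U W (i * b + ?j)"
  have "y div b < a" "?v (y div b) \<noteq> 0" using y by (auto intro: div_less_of_less_mult)
  from instrument_nonzero[OF E, of _ ?v, OF this] obtain x K l
    where x: "x < length E" and K: "K \<in> set (snd (E ! x))" and l: "l < fst (E ! x)"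
      and nz: "(\<Sum>i<a. K $$ (l, i) * ?v i) \<noteq> 0" by blast
  have "(\<Sum>i<a. K $$ (l, i) * ?v i) = amp t b (act a K U) W (l * b + ?j)"
    using j unfolding amp_def act_def
    by (simp add: sum_distrib_left sum_distrib_right mult.assoc) (rule sum.swap)
  with nz have "amp t b (act a K U) W (l * b + ?j) \<noteq> 0" by simp
  moreover have "l * b + ?j < fst (E ! x) * b" using l j by (rule mult_add_less)
  moreover have "act a K U \<in> set (concat (map (\<lambda>K. map (act a K) (As 0)) (snd (E ! x))))"
    using K UW by auto
  ultimately have "\<exists>U\<in>set (concat (map (\<lambda>K. map (act a K) (As 0)) (snd (E ! x)))).
      \<exists>W\<in>set (Bs 0). \<exists>y<fst (E ! x) * b. amp t b U W y \<noteq> 0"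
    using UW by blast
  with D have "dilated s c t (fst (E ! x)) b (\<lambda>m. concat (map (\<lambda>K. map (act a K) (As m)) (snd (E ! x)))) Bs
       (\<lambda>m. apply_kraus (fst (E ! x) * b) (map (\<lambda>K. K \<Otimes> 1\<^sub>m b) (snd (E ! x))) (\<rho> m))"
    unfolding dilated_def using mixture_Alice[OF _ is_instrument_nth_carrier[OF E x]]
    by (auto split: party.splits)
  with x that show ?thesis by blast
qed

lemma dilated_Bob:
  assumes D: "dilated s c t a b As Bs \<rho>" and E: "is_instrument b E"
  obtains x where "x < length E"
    "dilated s c t a (fst (E ! x)) As (\<lambda>m. concat (map (\<lambda>K. map (act b K) (Bs m)) (snd (E ! x))))
       (\<lambda>m. apply_kraus (a * fst (E ! x)) (map (\<lambda>K. 1\<^sub>m a \<Otimes> K) (snd (E ! x))) (\<rho> m))"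
proof -
  from D obtain U W y where UW: "U \<in> set (As 0)" "W \<in> set (Bs 0)" and y: "y < a * b" "amp t b U W y \<noteq> 0"
    by (auto simp: dilated_def)
  let ?i = "y div b"
  have i: "?i < a" using y by (auto intro: div_less_of_less_mult)
  let ?v = "\<lambda>j. amp t b U W (?i * b + j)"
  have "y mod b < b" "?v (y mod b) \<noteq> 0" using y by (auto intro: mod_less_of_less_mult)
  from instrument_nonzero[OF E, of _ ?v, OF this] obtain x K l
    where x: "x < length E" and K: "K \<in> set (snd (E ! x))" and l: "l < fst (E ! x)"
      and nz: "(\<Sum>j<b. K $$ (l, j) * ?v j) \<noteq> 0" by blast
  have "(\<Sum>j<b. K $$ (l, j) * ?v j) = (\<Sum>j<b. \<Sum>g<t. K $$ (l, j) * (U ?i g * W j g))"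
    by (simp add: amp_def sum_distrib_left)
  also have "\<dots> = amp t (fst (E ! x)) U (act b K W) (?i * fst (E ! x) + l)"
    using l unfolding amp_def act_def
    by (subst sum.swap) (simp add: sum_distrib_left mult.assoc mult.left_commute)
  finally have "amp t (fst (E ! x)) U (act b K W) (?i * fst (E ! x) + l) \<noteq> 0" using nz by simp
  moreover have "?i * fst (E ! x) + l < a * fst (E ! x)" using i l by (rule mult_add_less)
  moreover have "act b K W \<in> set (concat (map (\<lambda>K. map (act b K) (Bs 0)) (snd (E ! x))))"
    using K UW by auto
  ultimately have "\<exists>U\<in>set (As 0). \<exists>W\<in>set (concat (map (\<lambda>K. map (act b K) (Bs 0)) (snd (E ! x)))).
      \<exists>y<a * fst (E ! x). amp t (fst (E ! x)) U W y \<noteq> 0"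
    using UW by blast
  with D have "dilated s c t a (fst (E ! x)) As (\<lambda>m. concat (map (\<lambda>K. map (act b K) (Bs m)) (snd (E ! x))))
       (\<lambda>m. apply_kraus (a * fst (E ! x)) (map (\<lambda>K. 1\<^sub>m a \<Otimes> K) (snd (E ! x))) (\<rho> m))"
    unfolding dilated_def using mixture_Bob[OF _ is_instrument_nth_carrier[OF E x]]
    by (auto split: party.splits)
  with x that show ?thesis by blast
qed

lemma products_send_Alice:
  "0 < b \<Longrightarrow> products (t * 2) (2 * b) (map split_last As) (map (join_first b) Bs) = products t b As Bs"
  by (simp add: products_def o_def ext[OF amp_send_Alice])

lemma products_send_Bob:
  "0 < b \<Longrightarrow> products (t * 2) b (map join_last As) (map (split_first b) Bs) = products t (2 * b) As Bs"
  by (simp add: products_def o_def ext[OF amp_send_Bob])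

lemma dilated_send_Alice:
  assumes D: "dilated s c t (2 * a) b As Bs \<rho>"
  shows "dilated s c (t * 2) a (2 * b) (\<lambda>m. map split_last (As m)) (\<lambda>m. map (join_first b) (Bs m)) \<rho>"
proof -
  \<comment> \<open>The nonzero amplitude in \<open>dilated\<close> sits at an index below
    \<open>2 * a * b\<close>, which forces \<open>b\<close> to be positive.\<close>
  have b: "0 < b" using D by (auto simp: dilated_def intro: gr0I)
  show ?thesis
    using D unfolding dilated_def products_send_Alice[OF b] mult.commute[of 2 a] mult.assoc
    by (auto simp: amp_send_Alice[OF b] split: party.splits)
qed

lemma dilated_send_Bob:
  assumes D: "dilated s c t a (2 * b) As Bs \<rho>"
  shows "dilated s c (t * 2) (2 * a) b (\<lambda>m. map join_last (As m)) (\<lambda>m. map (split_first b) (Bs m)) \<rho>"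
proof -
  have b: "0 < b" using D by (auto simp: dilated_def intro: gr0I)
  show ?thesis
    using D unfolding dilated_def products_send_Bob[OF b] mult.commute[of 2 a] mult.assoc
    by (auto simp: amp_send_Bob[OF b] split: party.splits)
qed

text \<open>Induction along one transcript that serves all messages together; each of its
  \<open>q\<close> transmissions doubles the Schmidt bound. A reference system of dimension 1
  suffices for basis messages.\<close>

lemma dilated_branch:
  assumes "well_formed p a b a' b'" and "dilated s c t a b As Bs \<rho>"
  shows "\<exists>tr q As' Bs' \<tau>. (\<forall>m. (tr, q, \<tau> m) \<in> set (branches p 1 a b (\<rho> m)))
    \<and> dilated s c (t * 2 ^ q) a' b' As' Bs' \<tau>"
  using assms
proof (induction p arbitrary: a b t As Bs \<rho>)
  case Halt
  then show ?case
    by (intro exI[of _ "[]"] exI[of _ 0] exI[of _ As] exI[of _ Bs] exI[of _ \<rho>]) simp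
next
  case (Publish P E f)
  \<comment> \<open>The surviving outcome \<open>x\<close> and the local dimensions after it,
    phrased so that Alice's and Bob's cases share one continuation.\<close>
  have "\<exists>x d d' As' Bs' \<rho>'. x < length E \<and> well_formed (f x) d d' a' b' \<and> dilated s c t d d' As' Bs' \<rho>'
      \<and> (\<forall>m. (\<lambda>(tr, q, \<tau>). (x # tr, q, \<tau>)) ` set (branches (f x) 1 d d' (\<rho>' m))
          \<subseteq> set (branches (Publish P E f) 1 a b (\<rho> m)))"
  proof (cases P)
    case Alice
    with Publish.prems have E: "is_instrument a E" by simp
    from dilated_Alice[OF Publish.prems(2) E] obtain x where x: "x < length E"
      and D: "dilated s c t (fst (E ! x)) b (\<lambda>m. concat (map (\<lambda>K. map (act a K) (As m)) (snd (E ! x)))) Bs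
       (\<lambda>m. apply_kraus (fst (E ! x) * b) (map (\<lambda>K. K \<Otimes> 1\<^sub>m b) (snd (E ! x))) (\<rho> m))" by blast
    moreover have "well_formed (f x) (fst (E ! x)) b a' b'" using Publish.prems Alice x by simp
    ultimately show ?thesis using x Alice
      by (intro exI conjI allI) (auto simp: case_prod_beta Bex_def intro!: exI[of _ x])
  next
    case Bob
    with Publish.prems have E: "is_instrument b E" by simp
    from dilated_Bob[OF Publish.prems(2) E] obtain x where x: "x < length E"
      and D: "dilated s c t a (fst (E ! x)) As (\<lambda>m. concat (map (\<lambda>K. map (act b K) (Bs m)) (snd (E ! x))))
       (\<lambda>m. apply_kraus (a * fst (E ! x)) (map (\<lambda>K. 1\<^sub>m a \<Otimes> K) (snd (E ! x))) (\<rho> m))" by blast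
    moreover have "well_formed (f x) a (fst (E ! x)) a' b'" using Publish.prems Bob x by simp
    ultimately show ?thesis using x Bob
      by (intro exI conjI allI) (auto simp: case_prod_beta Bex_def intro!: exI[of _ x])
  qed
  then obtain x d d' As' Bs' \<rho>' where wf: "well_formed (f x) d d' a' b'"
    and D: "dilated s c t d d' As' Bs' \<rho>'"
    and sub: "\<And>m. (\<lambda>(tr, q, \<tau>). (x # tr, q, \<tau>)) ` set (branches (f x) 1 d d' (\<rho>' m))
          \<subseteq> set (branches (Publish P E f) 1 a b (\<rho> m))" by blast
  from Publish.IH[OF _ wf D] obtain tr q As'' Bs'' \<tau>
    where "\<And>m. (tr, q, \<tau> m) \<in> set (branches (f x) 1 d d' (\<rho>' m))"
      and D': "dilated s c (t * 2 ^ q) a' b' As'' Bs'' \<tau>" by blast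
  then have "(x # tr, q, \<tau> m) \<in> set (branches (Publish P E f) 1 a b (\<rho> m))" for m
    using sub[of m] by force
  with D' show ?case by blast
next
  case (Send P p)
  have "\<exists>d d' As' Bs'. well_formed p d d' a' b' \<and> dilated s c (t * 2) d d' As' Bs' \<rho>
      \<and> (\<forall>m. set (branches (Send P p) 1 a b (\<rho> m)) = (\<lambda>(tr, q, \<tau>). (tr, Suc q, \<tau>)) ` set (branches p 1 d d' (\<rho> m)))"
  proof (cases P)
    case Alice
    then obtain a2 where a: "a = 2 * a2" using Send.prems by (auto elim: evenE)
    show ?thesis using Alice a Send.prems dilated_send_Alice[of s c t a2 b As Bs \<rho>] by auto
  next
    case Bob
    then obtain b2 where b: "b = 2 * b2" using Send.prems by (auto elim: evenE)
    show ?thesis using Bob b Send.prems dilated_send_Bob[of s c t a b2 As Bs \<rho>] by auto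
  qed
  then obtain d d' As' Bs' where wf: "well_formed p d d' a' b'" and D: "dilated s c (t * 2) d d' As' Bs' \<rho>"
    and br: "\<And>m. set (branches (Send P p) 1 a b (\<rho> m)) = (\<lambda>(tr, q, \<tau>). (tr, Suc q, \<tau>)) ` set (branches p 1 d d' (\<rho> m))"
    by blast
  from Send.IH[OF wf D] obtain tr q As'' Bs'' \<tau>
    where "\<And>m. (tr, q, \<tau> m) \<in> set (branches p 1 d d' (\<rho> m))"
      and D': "dilated s c (t * 2 * 2 ^ q) a' b' As'' Bs'' \<tau>" by blast
  then have "(tr, Suc q, \<tau> m) \<in> set (branches (Send P p) 1 a b (\<rho> m))" for m
    unfolding br by force
  moreover have "dilated s c (t * 2 ^ Suc q) a' b' As'' Bs'' \<tau>" using D' by (simp add: mult.assoc)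
  ultimately show ?case by blast
qed

section \<open>Keys and messages\<close>

text \<open>The number \<open>n = k * 2 ^ M + m\<close> encodes the key \<open>k\<close> and the message \<open>m\<close>; \<open>pos_Alice\<close> and \<open>pos_Bob\<close> are
  the indices of the local basis states when \<open>P\<close> holds the message.\<close>

definition pos_Alice :: "party \<Rightarrow> nat \<Rightarrow> nat \<Rightarrow> nat" where
  "pos_Alice P M n = (case P of Alice \<Rightarrow> n | Bob \<Rightarrow> n div 2 ^ M)"

definition pos_Bob :: "party \<Rightarrow> nat \<Rightarrow> nat \<Rightarrow> nat" where
  "pos_Bob P M n = (case P of Alice \<Rightarrow> n div 2 ^ M | Bob \<Rightarrow> n)"

definition pos :: "party \<Rightarrow> nat \<Rightarrow> nat \<Rightarrow> nat \<Rightarrow> nat" where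
  "pos P K M n = pos_Alice P M n * dim_Bob P K M + pos_Bob P M n"

lemma pos_Alice_less: "n < 2 ^ K * 2 ^ M \<Longrightarrow> pos_Alice P M n < dim_Alice P K M"
  by (simp add: pos_Alice_def dim_Alice_def less_mult_imp_div_less split: party.splits)

lemma pos_Bob_less: "n < 2 ^ K * 2 ^ M \<Longrightarrow> pos_Bob P M n < dim_Bob P K M"
  by (simp add: pos_Bob_def dim_Bob_def less_mult_imp_div_less split: party.splits)

lemma pos_less: "n < 2 ^ K * 2 ^ M \<Longrightarrow> pos P K M n < dim_Alice P K M * dim_Bob P K M"
  unfolding pos_def by (intro mult_add_less pos_Alice_less pos_Bob_less)

section \<open>Joint basis states of key and message\<close>

lemma ket_carrier: "ket n i \<in> carrier_mat n 1"
  by (auto simp: ket_def)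

lemma index_ket: "x < n \<Longrightarrow> i < n \<Longrightarrow> ket n i $$ (x, 0) = (if x = i then 1 else 0)"
  by (simp add: ket_def mat_of_cols_index)

lemma mixture_basis_state:
  assumes "m < n"
  shows "mixture 1 n [\<lambda>x. if x = m then 1 else 0] (ket n m * mat_adjoint (ket n m))"
proof -
  have "ket n m * mat_adjoint (ket n m) \<in> carrier_mat n n"
    by (rule mult_carrier_mat[OF ket_carrier mat_adjoint_carrier[OF ket_carrier]])
  moreover have "(ket n m * mat_adjoint (ket n m)) $$ (x, y)
      = (if x = m then 1 else 0) * cnj (if y = m then 1 else 0)" if "x < n" "y < n" for x y
    using that assms carrier_matD[OF ket_carrier[of n m]]
    by (subst index_mult_mat_sum[OF ket_carrier mat_adjoint_carrier[OF ket_carrier]])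
      (simp_all add: index_ket)
  ultimately show ?thesis by (simp add: mixture_def)
qed

lemma add_key_carrier:
  "add_key 1 K M P k \<in> carrier_mat (dim_Alice P K M * dim_Bob P K M) (2 ^ M)"
proof (cases P)
  case Alice
  have "(ket (2 ^ K) k \<Otimes> 1\<^sub>m (2 ^ M)) \<Otimes> ket (2 ^ K) k \<in> carrier_mat ((2 ^ K * 2 ^ M) * 2 ^ K) ((1 * 2 ^ M) * 1)"
    by (intro kron_carrier ket_carrier one_carrier_mat)
  with Alice show ?thesis by (simp add: add_key_def dim_Alice_def dim_Bob_def)
next
  case Bob
  have "ket (2 ^ K) k \<Otimes> (ket (2 ^ K) k \<Otimes> 1\<^sub>m (2 ^ M)) \<in> carrier_mat (2 ^ K * (2 ^ K * 2 ^ M)) (1 * (1 * 2 ^ M))"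
    by (intro kron_carrier ket_carrier one_carrier_mat)
  with Bob show ?thesis by (simp add: add_key_def dim_Alice_def dim_Bob_def)
qed

lemma div_mod_eq_iff: "j < n \<Longrightarrow> x = i * n + j \<longleftrightarrow> x div n = i \<and> x mod n = (j::nat)"
  by (metis div_mult_add mod_mult_add div_mult_mod_eq)

text \<open>Each column of the isometry is a single joint basis vector: the key occurs in both local
  blocks, the message only in that of \<open>P\<close>.\<close>

lemma index_add_key:
  assumes k: "k < 2 ^ K" and m: "m < 2 ^ M" and x: "x < dim_Alice P K M * dim_Bob P K M"
  shows "add_key 1 K M P k $$ (x, m) = (if x = pos P K M (k * 2 ^ M + m) then 1 else 0)"
proof (cases P)
  case Alice
  let ?N = "2 ^ K :: nat"
  have x': "x < (?N * 2 ^ M) * ?N" using x Alice by (simp add: dim_Alice_def dim_Bob_def)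
  have xd: "x div ?N < ?N * 2 ^ M" "x mod ?N < ?N" using x' by (auto intro: div_less_of_less_mult)
  have xdd: "x div ?N div 2 ^ M < ?N" using xd by (auto intro: div_less_of_less_mult)
  have "add_key 1 K M P k $$ (x, m) = ((ket ?N k \<Otimes> 1\<^sub>m (2 ^ M)) \<Otimes> ket ?N k) $$ (x, m)"
    using Alice by (simp add: add_key_def)
  also have "\<dots> = (ket ?N k \<Otimes> 1\<^sub>m (2 ^ M)) $$ (x div ?N, m) * ket ?N k $$ (x mod ?N, 0)"
    using m by (subst index_kron[OF kron_carrier[OF ket_carrier one_carrier_mat] ket_carrier x']) auto
  also have "(ket ?N k \<Otimes> 1\<^sub>m (2 ^ M)) $$ (x div ?N, m)
      = ket ?N k $$ (x div ?N div 2 ^ M, 0) * 1\<^sub>m (2 ^ M) $$ (x div ?N mod 2 ^ M, m)"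
    using m by (subst index_kron[OF ket_carrier one_carrier_mat xd(1)]) auto
  finally show ?thesis
    using Alice k m xd xdd
    by (simp add: index_ket pos_def pos_Alice_def pos_Bob_def dim_Bob_def div_mod_eq_iff)
next
  case Bob
  let ?N = "2 ^ K :: nat"
  let ?L = "?N * 2 ^ M"
  have x': "x < ?N * ?L" using x Bob by (simp add: dim_Alice_def dim_Bob_def)
  have xd: "x div ?L < ?N" "x mod ?L < ?L" using x' by (auto intro: div_less_of_less_mult)
  have xdd: "x mod ?L div 2 ^ M < ?N" using xd by (auto intro: div_less_of_less_mult)
  have j: "k * 2 ^ M + m < ?L" using k m by (rule mult_add_less)
  have "add_key 1 K M P k $$ (x, m) = (ket ?N k \<Otimes> (ket ?N k \<Otimes> 1\<^sub>m (2 ^ M))) $$ (x, m)"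
    using Bob by (simp add: add_key_def)
  also have "\<dots> = ket ?N k $$ (x div ?L, 0) * (ket ?N k \<Otimes> 1\<^sub>m (2 ^ M)) $$ (x mod ?L, m)"
    using m by (subst index_kron[OF ket_carrier kron_carrier[OF ket_carrier one_carrier_mat] x']) auto
  also have "(ket ?N k \<Otimes> 1\<^sub>m (2 ^ M)) $$ (x mod ?L, m)
      = ket ?N k $$ (x mod ?L div 2 ^ M, 0) * 1\<^sub>m (2 ^ M) $$ (x mod ?L mod 2 ^ M, m)"
    using m by (subst index_kron[OF ket_carrier one_carrier_mat xd(2)]) auto
  finally have entry: "add_key 1 K M P k $$ (x, m) = ket ?N k $$ (x div ?L, 0) *
      (ket ?N k $$ (x mod ?L div 2 ^ M, 0) * 1\<^sub>m (2 ^ M) $$ (x mod ?L mod 2 ^ M, m))" .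
  have "x = pos P K M (k * 2 ^ M + m) \<longleftrightarrow> x div ?L = k \<and> x mod ?L = k * 2 ^ M + m"
    using Bob m j by (simp add: pos_def pos_Alice_def pos_Bob_def dim_Bob_def div_mod_eq_iff del: mod_mult_self4)
  also have "\<dots> \<longleftrightarrow> x div ?L = k \<and> x mod ?L div 2 ^ M = k \<and> x mod ?L mod 2 ^ M = m"
    using m by (simp only: div_mod_eq_iff)
  finally show ?thesis
    unfolding entry using k m xd xdd by (simp add: index_ket)
qed

abbreviation basis_message :: "nat \<Rightarrow> nat \<Rightarrow> complex mat" where
  "basis_message M m \<equiv> ket (2 ^ M) m * mat_adjoint (ket (2 ^ M) m)"

lemma mixture_keyed_state:
  assumes m: "m < 2 ^ M"
  shows "mixture (1 / 2 ^ K) (dim_Alice P K M * dim_Bob P K M)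
    (map (\<lambda>k x. if x = pos P K M (k * 2 ^ M + m) then 1 else 0) [0..<2 ^ K])
    (keyed_state 1 K M P (basis_message M m))"
proof -
  let ?n = "dim_Alice P K M * dim_Bob P K M"
  have "set (map (add_key 1 K M P) [0..<2 ^ K]) \<subseteq> carrier_mat ?n (2 ^ M)"
    using add_key_carrier by auto
  from mixture_apply_kraus[OF mixture_basis_state[OF m] this]
  have "mixture 1 ?n (map (\<lambda>k x. \<Sum>y<2 ^ M. add_key 1 K M P k $$ (x, y) * (if y = m then 1 else 0)) [0..<2 ^ K])
      (apply_kraus ?n (map (add_key 1 K M P) [0..<2 ^ K]) (basis_message M m))"
    by (simp add: o_def concat_map_singleton)
  then have "mixture 1 ?n (map (\<lambda>k x. if x = pos P K M (k * 2 ^ M + m) then 1 else 0) [0..<2 ^ K])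
      (apply_kraus ?n (map (add_key 1 K M P) [0..<2 ^ K]) (basis_message M m))"
    by (rule mixture_cong)
      (use m in \<open>auto intro!: arg_cong[where f=sum_list] simp: o_def index_add_key[unfolded One_nat_def] if_distrib[of "\<lambda>c. _ * c"] cong: if_cong\<close>)
  from mixture_smult[OF this, of "1 / 2 ^ K"] show ?thesis
    by (simp add: keyed_state_def)
qed

section \<open>The shared key as correlated records\<close>

text \<open>The record is the key value \<open>k\<close>, as if half of an unnormalised maximally
  entangled state of dimension \<open>2 ^ K\<close> had been projected onto \<open>k\<close>. Since
  \<open>products\<close> pairs records freely, it is the Schmidt index that correlates the two
  keys.\<close>

definition key_Alice :: "party \<Rightarrow> nat \<Rightarrow> nat \<Rightarrow> nat \<Rightarrow> (nat \<Rightarrow> nat \<Rightarrow> complex) list" where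
  "key_Alice P K M m =
     map (\<lambda>k i g. if g = k \<and> i = pos_Alice P M (k * 2 ^ M + m) then 1 else 0) [0..<2 ^ K]"

definition key_Bob :: "party \<Rightarrow> nat \<Rightarrow> nat \<Rightarrow> nat \<Rightarrow> (nat \<Rightarrow> nat \<Rightarrow> complex) list" where
  "key_Bob P K M m =
     map (\<lambda>k j g. if g = k \<and> j = pos_Bob P M (k * 2 ^ M + m) then 1 else 0) [0..<2 ^ K]"

text \<open>Different records \<open>k\<close> and \<open>k'\<close> select different Schmidt
  indices, so their pair contributes the zero vector.\<close>

lemma amp_key:
  assumes k: "k < 2 ^ K" "k' < 2 ^ K" and m: "m < 2 ^ M"
  shows "amp (2 ^ K) (dim_Bob P K M)
      (\<lambda>i g. if g = k \<and> i = pos_Alice P M (k * 2 ^ M + m) then 1 else 0)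
      (\<lambda>j g. if g = k' \<and> j = pos_Bob P M (k' * 2 ^ M + m) then 1 else 0) x
    = (if k = k' \<and> x = pos P K M (k * 2 ^ M + m) then 1 else 0)"
proof -
  have "k * 2 ^ M + m < 2 ^ K * 2 ^ M" using k m by (intro mult_add_less)
  then have x: "x = pos P K M (k * 2 ^ M + m) \<longleftrightarrow>
      x div dim_Bob P K M = pos_Alice P M (k * 2 ^ M + m) \<and> x mod dim_Bob P K M = pos_Bob P M (k * 2 ^ M + m)"
    unfolding pos_def by (intro div_mod_eq_iff pos_Bob_less)
  have "amp (2 ^ K) (dim_Bob P K M)
      (\<lambda>i g. if g = k \<and> i = pos_Alice P M (k * 2 ^ M + m) then 1 else 0)
      (\<lambda>j g. if g = k' \<and> j = pos_Bob P M (k' * 2 ^ M + m) then 1 else 0) x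
    = (\<Sum>g<2 ^ K. if g = k then (if k = k' \<and> x = pos P K M (k * 2 ^ M + m) then 1 else 0) else 0)"
    unfolding amp_def x by (intro sum.cong) auto
  then show ?thesis using k by simp
qed

text \<open>The initial state, with Schmidt bound \<open>2 ^ K\<close>. Labels are reduced modulo
  \<open>2 ^ M\<close> because \<open>dilated\<close> speaks of all natural numbers
  \<open>m\<close>.\<close>

lemma dilated_keyed_state:
  "dilated P (1 / 2 ^ K) (2 ^ K) (dim_Alice P K M) (dim_Bob P K M)
     (\<lambda>m. key_Alice P K M (m mod 2 ^ M)) (\<lambda>m. key_Bob P K M (m mod 2 ^ M))
     (\<lambda>m. keyed_state 1 K M P (basis_message M (m mod 2 ^ M)))"
proof -
  have mix: "mixture (1 / 2 ^ K) (dim_Alice P K M * dim_Bob P K M)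
      (products (2 ^ K) (dim_Bob P K M) (key_Alice P K M m) (key_Bob P K M m))
      (keyed_state 1 K M P (basis_message M m))" if m: "m < 2 ^ M" for m
  proof (rule mixture_cong[OF mixture_keyed_state[OF m]])
    fix x y
    let ?e = "\<lambda>k x. if x = pos P K M (k * 2 ^ M + m) then 1 else 0 :: complex"
    have "(\<Sum>v\<leftarrow>products (2 ^ K) (dim_Bob P K M) (key_Alice P K M m) (key_Bob P K M m). v x * cnj (v y))
        = (\<Sum>k<2 ^ K. \<Sum>k'<2 ^ K. if k = k' then ?e k x * cnj (?e k y) else 0)"
      unfolding sum_list_products key_Alice_def key_Bob_def map_map o_def
        sum_set_upt_conv_sum_list_nat[symmetric] set_upt atLeast0LessThan
      using m by (intro sum.cong refl) (simp add: amp_key)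
    also have "\<dots> = (\<Sum>k<2 ^ K. ?e k x * cnj (?e k y))"
      by (intro sum.cong refl) (simp only: sum.delta finite_lessThan lessThan_iff sum.delta' if_True)
    also have "\<dots> = (\<Sum>v\<leftarrow>map (\<lambda>k x. ?e k x) [0..<2 ^ K]. v x * cnj (v y))"
      unfolding map_map o_def sum_set_upt_conv_sum_list_nat[symmetric] set_upt atLeast0LessThan ..
    finally show "(\<Sum>v\<leftarrow>map (\<lambda>k x. ?e k x) [0..<2 ^ K]. v x * cnj (v y))
        = (\<Sum>v\<leftarrow>products (2 ^ K) (dim_Bob P K M) (key_Alice P K M m) (key_Bob P K M m). v x * cnj (v y))"
      by (rule sym)
  qed
  \<comment> \<open>The party without the message sits at
    \<open>(k * 2 ^ M + m) div 2 ^ M = k\<close> for every \<open>m < 2 ^ M\<close>.\<close>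
  have const: "case P of Alice \<Rightarrow> \<exists>Bs0. (\<lambda>m. key_Bob P K M (m mod 2 ^ M)) = (\<lambda>_. Bs0)
      | Bob \<Rightarrow> \<exists>As0. (\<lambda>m. key_Alice P K M (m mod 2 ^ M)) = (\<lambda>_. As0)"
    by (auto simp: key_Alice_def key_Bob_def pos_Alice_def pos_Bob_def split: party.splits)
  have "0 < (2::nat) ^ K * 2 ^ M" by simp
  from pos_less[OF this] have "pos P K M 0 < dim_Alice P K M * dim_Bob P K M" .
  moreover have "(\<lambda>i g. if g = 0 \<and> i = pos_Alice P M (0 * 2 ^ M + 0) then 1 else 0) \<in> set (key_Alice P K M 0)"
    unfolding key_Alice_def set_map by (rule imageI) simp
  moreover have "(\<lambda>j g. if g = 0 \<and> j = pos_Bob P M (0 * 2 ^ M + 0) then 1 else 0) \<in> set (key_Bob P K M 0)"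
    unfolding key_Bob_def set_map by (rule imageI) simp
  moreover have "amp (2 ^ K) (dim_Bob P K M)
      (\<lambda>i g. if g = 0 \<and> i = pos_Alice P M (0 * 2 ^ M + 0) then 1 else 0)
      (\<lambda>j g. if g = 0 \<and> j = pos_Bob P M (0 * 2 ^ M + 0) then 1 else 0) (pos P K M 0) \<noteq> 0"
    by (subst amp_key) simp_all
  ultimately have "\<exists>U\<in>set (key_Alice P K M 0). \<exists>W\<in>set (key_Bob P K M 0).
      \<exists>x<dim_Alice P K M * dim_Bob P K M. amp (2 ^ K) (dim_Bob P K M) U W x \<noteq> 0" by blast
  with mix const show ?thesis
    by (simp add: dilated_def)
qed

text \<open>Here \<open>P\<close> is the receiver. Choosing for each \<open>n\<close> a pair of
  records with nonzero amplitude at \<open>pos P K M n\<close> yields a diagonal matrix of size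
  \<open>2 ^ K * 2 ^ M\<close> that factors through \<open>t\<close> Schmidt indices, so
  \<open>rank_bound\<close> applies.\<close>

lemma dilated_keyed_state_rank:
  assumes D: "dilated (other P) c t (dim_Alice P K M) (dim_Bob P K M) As Bs \<tau>" and c: "c \<noteq> 0"
    and \<tau>: "\<And>m. m < 2 ^ M \<Longrightarrow> \<tau> m = d \<cdot>\<^sub>m keyed_state 1 K M P (basis_message M m)"
  shows "d \<noteq> 0" and "2 ^ K * 2 ^ M \<le> t"
proof -
  let ?b = "dim_Bob P K M"
  let ?n = "dim_Alice P K M * ?b"
  \<comment> \<open>Both sides say that the diagonal entry of \<open>\<tau> m\<close> at
    \<open>x\<close> is nonzero, read once from the records and once from the required final
    state.\<close>
  have supp: "(\<exists>U\<in>set (As m). \<exists>W\<in>set (Bs m). amp t ?b U W x \<noteq> 0)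
      \<longleftrightarrow> d \<noteq> 0 \<and> (\<exists>k<2 ^ K. x = pos P K M (k * 2 ^ M + m))"
    if m: "m < 2 ^ M" and x: "x < ?n" for m x
  proof -
    have "mixture c ?n (products t ?b (As m) (Bs m)) (\<tau> m)" using D by (simp add: dilated_def)
    from mixture_diag_eq_0_iff[OF this c x]
    have "\<tau> m $$ (x, x) \<noteq> 0 \<longleftrightarrow> (\<exists>U\<in>set (As m). \<exists>W\<in>set (Bs m). amp t ?b U W x \<noteq> 0)"
      by (auto simp: products_def)
    moreover have "keyed_state 1 K M P (basis_message M m) $$ (x, x) \<noteq> 0
        \<longleftrightarrow> (\<exists>k<2 ^ K. x = pos P K M (k * 2 ^ M + m))"
      by (subst mixture_diag_eq_0_iff[OF mixture_keyed_state[OF m] _ x]) auto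
    moreover have "keyed_state 1 K M P (basis_message M m) \<in> carrier_mat ?n ?n"
      using mixture_keyed_state[OF m, of K P] by (simp add: mixture_def)
    ultimately show ?thesis using x \<tau>[OF m] by simp
  qed
  show d: "d \<noteq> 0"
    using D supp[of 0] by (auto simp: dilated_def)
  have ex: "\<exists>U W. U \<in> set (As (n mod 2 ^ M)) \<and> W \<in> set (Bs (n mod 2 ^ M)) \<and> amp t ?b U W (pos P K M n) \<noteq> 0"
    if n: "n < 2 ^ K * 2 ^ M" for n
  proof -
    have "n div 2 ^ M < 2 ^ K" using n by (rule div_less_of_less_mult)
    then have "\<exists>k<2 ^ K. pos P K M n = pos P K M (k * 2 ^ M + n mod 2 ^ M)"
      by (intro exI[of _ "n div 2 ^ M"]) (simp only: div_mult_mod_eq simp_thms)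
    with supp[of "n mod 2 ^ M" "pos P K M n"] d pos_less[OF n] show ?thesis by auto
  qed
  then obtain U W where UW: "\<And>n. n < 2 ^ K * 2 ^ M \<Longrightarrow>
      U n \<in> set (As (n mod 2 ^ M)) \<and> W n \<in> set (Bs (n mod 2 ^ M)) \<and> amp t ?b (U n) (W n) (pos P K M n) \<noteq> 0"
    by metis
  \<comment> \<open>Rows come from Alice's records and columns from Bob's, so an off-diagonal entry
    is an amplitude at a mixed position.\<close>
  have amp_eq: "(\<Sum>g<t. U n (pos_Alice P M n) g * W n' (pos_Bob P M n') g)
      = amp t ?b (U n) (W n') (pos_Alice P M n * ?b + pos_Bob P M n')"
    if "n' < 2 ^ K * 2 ^ M" for n n'
    using pos_Bob_less[OF that, of P] by (simp add: amp_def)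
  show "2 ^ K * 2 ^ M \<le> t"
  proof (rule rank_bound)
    fix n :: nat assume n: "n < 2 ^ K * 2 ^ M"
    show "(\<Sum>g<t. U n (pos_Alice P M n) g * W n (pos_Bob P M n) g) \<noteq> 0"
      using UW[OF n] by (simp add: amp_eq[OF n] pos_def)
  next
    fix n n' :: nat assume n: "n < 2 ^ K * 2 ^ M" "n' < 2 ^ K * 2 ^ M" and ne: "n \<noteq> n'"
    \<comment> \<open>The sender is \<open>other P\<close>, so the record of \<open>P\<close> fits every message.\<close>
    define m where "m = (case P of Alice \<Rightarrow> n' mod 2 ^ M | Bob \<Rightarrow> n mod 2 ^ M)"
    have m: "m < 2 ^ M" by (simp add: m_def split: party.splits)
    have U: "U n \<in> set (As m)" and W: "W n' \<in> set (Bs m)"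
      using UW[OF n(1)] UW[OF n(2)] D by (auto simp: dilated_def m_def split: party.splits)
    let ?x = "pos_Alice P M n * ?b + pos_Bob P M n'"
    have x: "?x < ?n" using n by (intro mult_add_less pos_Alice_less pos_Bob_less)
    have "amp t ?b (U n) (W n') ?x = 0"
    proof (rule ccontr)
      assume "amp t ?b (U n) (W n') ?x \<noteq> 0"
      with supp[OF m x] U W obtain k where k: "k < 2 ^ K" "?x = pos P K M (k * 2 ^ M + m)" by blast
      have "k * 2 ^ M + m < 2 ^ K * 2 ^ M" using k m by (intro mult_add_less)
      from pos_Bob_less[OF this, of P] pos_Bob_less[OF n(2), of P] k(2)
      have "pos_Alice P M n = pos_Alice P M (k * 2 ^ M + m)" "pos_Bob P M n' = pos_Bob P M (k * 2 ^ M + m)"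
        unfolding pos_def by (metis div_mult_add, metis mod_mult_add)
      \<comment> \<open>The receiver's index fixes key and message, the sender's only the key. For
        \<open>P = Alice\<close> this gives \<open>n = k * 2 ^ M + m\<close> and
        \<open>k = n' div 2 ^ M\<close>, and \<open>m = n' mod 2 ^ M\<close> by choice; Bob's case
        is symmetric.\<close>
      with m have "n = n'"
        by (cases P) (simp_all add: pos_Alice_def pos_Bob_def m_def, (metis div_mult_mod_eq)+)
      with ne show False by simp
    qed
    then show "(\<Sum>g<t. U n (pos_Alice P M n) g * W n' (pos_Bob P M n') g) = 0"
      by (simp add: amp_eq[OF n(2)])
  qed
qed

section \<open>Basis messages as admissible inputs\<close>

lemma density_operator_basis_message:
  assumes m: "m < n"
  shows "density_operator n (ket n m * mat_adjoint (ket n m))"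
proof -
  let ?\<sigma> = "ket n m * mat_adjoint (ket n m)"
  have \<sigma>: "?\<sigma> \<in> carrier_mat n n"
    by (rule mult_carrier_mat[OF ket_carrier mat_adjoint_carrier[OF ket_carrier]])
  have ix: "?\<sigma> $$ (x, y) = (if x = m \<and> y = m then 1 else 0)" if "x < n" "y < n" for x y
    using mixture_basis_state[OF m] that by (auto simp: mixture_def)
  have "0 \<le> (?\<sigma> *\<^sub>v v) \<bullet>c v" if v: "v \<in> carrier_vec n" for v
  proof -
    have "?\<sigma> *\<^sub>v v = vec n (\<lambda>x. if x = m then v $ m else 0)"
      using \<sigma> v m ix by (intro eq_vecI) (auto simp: scalar_prod_def if_distrib[of "\<lambda>c. c * _"] cong: if_cong)
    then have "(?\<sigma> *\<^sub>v v) \<bullet>c v = v $ m * cnj (v $ m)"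
      using v m by (simp add: scalar_prod_def if_distrib[of "\<lambda>c. c * _"] cong: if_cong)
    then show ?thesis by (simp add: complex_mult_cnj less_eq_complex_def)
  qed
  moreover have "(\<Sum>i<n. ?\<sigma> $$ (i, i)) = 1" using m by (simp add: ix)
  ultimately show ?thesis using \<sigma> by (simp add: density_operator_def)
qed

text \<open>Reduces quantum messages to the argument for classical ones.\<close>

lemma message_state_basis: "m < 2 ^ M \<Longrightarrow> message_state kind M 1 (basis_message M m)"
  using density_operator_basis_message[of m "2 ^ M"]
  by (auto simp: message_state_def split: message_kind.splits)

lemma other_other [simp]: "other (other P) = P"
  by (cases P) simp_all

theorem mainTheorem3:
  fixes kind :: message_kind and sender :: party and p :: protocol
    and K_start K_end \<delta>Q \<delta>M :: nat and \<delta>K :: int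
  assumes "private_protocol kind sender p K_start K_end \<delta>M \<delta>Q"
    and "\<delta>K = int K_end - int K_start"
  shows "\<delta>K \<le> int \<delta>Q - int \<delta>M"
proof -
  let ?R = "other sender"
  let ?\<rho> = "\<lambda>m. keyed_state 1 K_start \<delta>M sender (basis_message \<delta>M (m mod 2 ^ \<delta>M))"
  from assms(1) obtain prob :: "nat list \<Rightarrow> real"
    where wf: "well_formed p (dim_Alice sender K_start \<delta>M) (dim_Bob sender K_start \<delta>M)
        (dim_Alice ?R K_end \<delta>M) (dim_Bob ?R K_end \<delta>M)"
      and run: "\<And>r \<sigma> tr q \<tau>. message_state kind \<delta>M r \<sigma> \<Longrightarrow>
        (tr, q, \<tau>) \<in> set (branches p r (dim_Alice sender K_start \<delta>M) (dim_Bob sender K_start \<delta>M)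
          (keyed_state r K_start \<delta>M sender \<sigma>)) \<Longrightarrow>
        \<tau> = complex_of_real (prob tr) \<cdot>\<^sub>m keyed_state r K_end \<delta>M ?R \<sigma> \<and> (prob tr \<noteq> 0 \<longrightarrow> q \<le> \<delta>Q)"
    unfolding private_protocol_def by blast
  from dilated_branch[OF wf dilated_keyed_state] obtain tr q As Bs \<tau>
    where br: "\<And>m. (tr, q, \<tau> m) \<in> set (branches p 1 (dim_Alice sender K_start \<delta>M) (dim_Bob sender K_start \<delta>M) (?\<rho> m))"
      and D: "dilated sender (1 / 2 ^ K_start) (2 ^ K_start * 2 ^ q)
        (dim_Alice ?R K_end \<delta>M) (dim_Bob ?R K_end \<delta>M) As Bs \<tau>"
    by blast
  \<comment> \<open>Privacy of the message enters here: the factor \<open>prob tr\<close> is the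
    same for every \<open>m\<close>.\<close>
  have fin: "\<tau> m = complex_of_real (prob tr) \<cdot>\<^sub>m keyed_state 1 K_end \<delta>M ?R (basis_message \<delta>M m)
      \<and> (prob tr \<noteq> 0 \<longrightarrow> q \<le> \<delta>Q)" if "m < 2 ^ \<delta>M" for m
    using run[OF message_state_basis[OF that]] br[of m] that by simp
  have D': "dilated (other ?R) (1 / 2 ^ K_start) (2 ^ K_start * 2 ^ q)
        (dim_Alice ?R K_end \<delta>M) (dim_Bob ?R K_end \<delta>M) As Bs \<tau>"
    using D by simp
  have "complex_of_real (prob tr) \<noteq> 0" and le: "2 ^ K_end * 2 ^ \<delta>M \<le> (2 ^ K_start * 2 ^ q :: nat)"
    using dilated_keyed_state_rank[OF D' _ conjunct1[OF fin]] by simp_all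
  \<comment> \<open>The transcript has nonzero probability, so the limit on sent qubits applies to
    it.\<close>
  then have "q \<le> \<delta>Q" using fin[of 0] by simp
  moreover have "K_end + \<delta>M \<le> K_start + q"
    using le unfolding power_add[symmetric] by (rule power_le_imp_le_exp[rotated]) simp
  ultimately show ?thesis using assms(2) by simp
qed

end
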